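(* Let $w$ be an integrable weight function on $[-1,1]$ with $w(x)>0$ almost everywhere, let $n\ge 1$, let $t_1,t_2,\ldots\in(-1,1)$, and put $\pi_m(x)=\prod_{i=1}^m(1+t_ix)$ and $\phi_k(x)=\frac{1}{1+t_kx}$. (1) Suppose all the $t_i$ are different. Then the $n$ nodes for orthogonal quadrature (with parameters $t_1,\ldots,t_{n+1}$) are the zeros $x_{j,n}$ $(1\le j\le n)$ of the orthogonal polynomial $p_n(x)$ of degree $n$ with respect to the weight function $$w_n(x)=\frac{w(x)}{\pi_n(x)\pi_{n+1}(x)},\qquad -1<x<1.$$ If in addition $t_1=0$, then $$\int_{-1}^1\phi_k(x)w(x)\,dx=\sum_{j=1}^n\beta_j\,\phi_k(x_{j,n})\qquad\text{for } k=1,2,\ldots,n+1,$$ with $\beta_j=\beta_j(t_1,\ldots,t_{n+1})=\pi_{n+1}(x_{j,n})\pi_n(x_{j,n})\lambda_{j,n}$, where $\lambda_{j,n}$ are the Christoffel numbers corresponding to the orthogonal polynomial $p_n$ for this weight function $w_n$. (2) Suppose all the $t_i$ are different. Then the $n$ nodes for Gaussian quadrature (with parameters $t_1,\ldots,t_{2n}$) are the zeros $x_{j,n}$ $(1\le j\le n)$ of the orthogonal polynomial $p_n(x)$ of degree $n$ with respect to the weight function $$w_n(x)=\frac{w(x)}{\pi_{2n}(x)},\qquad -1<x<1,$$ and $$\int_{-1}^1\phi_k(x)w(x)\,dx=\sum_{j=1}^n\beta_j\,\phi_k(x_{j,n})\qquad\text{for } k=1,2,\ldots,2n,$$ with $\beta_j=\beta_j(t_1,\ldots,t_{2n})=\pi_{2n}(x_{j,n})\lambda_{j,n}$,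 where $\lambda_{j,n}$ are the Christoffel numbers corresponding to $p_n$ for this weight function $w_n$.
   Context: Inner product: $(f,g)=\int_{-1}^1 f(x)g(x)w(x)\,dx$. Orthogonal functions: for distinct $t_1,\ldots,t_{n+1}\in(-1,1)$, $r_{n+1}(t_1,\ldots,t_{n+1};x)=\frac{1}{1+t_{n+1}x}+\sum_{i=1}^n\frac{c_i}{1+t_ix}$, where the real numbers $c_1,\ldots,c_n$ are chosen so that this function is orthogonal, for $(\cdot,\cdot)$, to $\frac{1}{1+t_ix}$ for $i=1,\ldots,n$. It has precisely $n$ zeros in $(-1,1)$ and these are simple; they are called the $n$ nodes for orthogonal quadrature. Gaussian quadrature: for distinct $t_1,\ldots,t_{2n}\in(-1,1)$ there is a unique set of $n$ distinct nodes $x_1,\ldots,x_n\in(-1,1)$ with strictly positive weights $\beta_1,\ldots,\beta_n$ such that $\int_{-1}^1\frac{w(x)}{1+t_kx}\,dx=\sum_{i=1}^n\frac{\beta_i}{1+t_kx_i}$ for $k=1,\ldots,2n$. These $x_i$ are called the nodes for Gaussian quadrature. Christoffel numbers: if $x_{1,n},\ldots,x_{n,n}$ are the zeros of the degree-$n$ orthogonal polynomial for a weight $w_n$ on $[-1,1]$, the Christoffel numbers $\lambda_{j,n}$ are the weights of the Gauss–Jacobi formula $\int_{-1}^1 q(x)w_n(x)\,dx=\sum_{j=1}^n\lambda_{j,n}q(x_{j,n})$, valid for all polynomials $q$ of degree at most $2n-1$. *)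

theory Defs
  imports "HOL-Analysis.Analysis" "HOL-Computational_Algebra.Polynomial"
begin

definition weighted_inner :: "(real \<Rightarrow> real) \<Rightarrow> (real \<Rightarrow> real) \<Rightarrow> (real \<Rightarrow> real) \<Rightarrow> real" where
  "weighted_inner w f g = (LINT x:{-1..1}|lebesgue. f x * g x * w x)"

(* Parameters are indexed from 1; the value t 0 is never used. *)

definition phi :: "(nat \<Rightarrow> real) \<Rightarrow> nat \<Rightarrow> real \<Rightarrow> real" where
  "phi t k x = 1 / (1 + t k * x)"

definition pi_prod :: "(nat \<Rightarrow> real) \<Rightarrow> nat \<Rightarrow> real \<Rightarrow> real" where
  "pi_prod t m x = (\<Prod>i=1..m. 1 + t i * x)"

(* The function r_{n+1} with coefficients c 1, ..., c n. *)
definition r_fun :: "(nat \<Rightarrow> real) \<Rightarrow> nat \<Rightarrow> (nat \<Rightarrow> real) \<Rightarrow> real \<Rightarrow> real" where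
  "r_fun t n c x = 1 / (1 + t (n + 1) * x) + (\<Sum>i=1..n. c i / (1 + t i * x))"

definition orthogonal_coeffs ::
    "(real \<Rightarrow> real) \<Rightarrow> (nat \<Rightarrow> real) \<Rightarrow> nat \<Rightarrow> (nat \<Rightarrow> real) \<Rightarrow> bool" where
  "orthogonal_coeffs w t n c \<longleftrightarrow>
     (\<forall>i\<in>{1..n}. weighted_inner w (r_fun t n c) (phi t i) = 0)"

definition is_orthogonal_nodes ::
    "(real \<Rightarrow> real) \<Rightarrow> (nat \<Rightarrow> real) \<Rightarrow> nat \<Rightarrow> real set \<Rightarrow> bool" where
  "is_orthogonal_nodes w t n X \<longleftrightarrow>
     (\<exists>c. orthogonal_coeffs w t n c \<and> X = {x \<in> {-1<..<1}. r_fun t n c x = 0})"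

definition is_gaussian_nodes ::
    "(real \<Rightarrow> real) \<Rightarrow> (nat \<Rightarrow> real) \<Rightarrow> nat \<Rightarrow> real set \<Rightarrow> bool" where
  "is_gaussian_nodes w t n X \<longleftrightarrow>
     finite X \<and> card X = n \<and> X \<subseteq> {-1<..<1} \<and>
     (\<exists>\<beta>. (\<forall>y\<in>X. \<beta> y > 0) \<and>
        (\<forall>k\<in>{1..2*n}. (LINT x:{-1..1}|lebesgue. w x / (1 + t k * x))
                        = (\<Sum>y\<in>X. \<beta> y / (1 + t k * y))))"

(* No normalisation is imposed, so p is determined up to a nonzero constant factor only. *)
definition is_orthogonal_poly :: "(real \<Rightarrow> real) \<Rightarrow> nat \<Rightarrow> real poly \<Rightarrow> bool" where
  "is_orthogonal_poly v n p \<longleftrightarrow>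
     p \<noteq> 0 \<and> degree p = n \<and>
     (\<forall>q. degree q < n \<longrightarrow> weighted_inner v (poly p) (poly q) = 0)"

definition enumerates_zeros :: "nat \<Rightarrow> real poly \<Rightarrow> (nat \<Rightarrow> real) \<Rightarrow> bool" where
  "enumerates_zeros n p x \<longleftrightarrow> bij_betw x {1..n} {y. poly p y = 0}"

definition is_christoffel ::
    "(real \<Rightarrow> real) \<Rightarrow> nat \<Rightarrow> (nat \<Rightarrow> real) \<Rightarrow> (nat \<Rightarrow> real) \<Rightarrow> bool" where
  "is_christoffel v n x lam \<longleftrightarrow>
     (\<forall>q :: real poly. degree q \<le> 2 * n - 1 \<longrightarrow>
        (LINT y:{-1..1}|lebesgue. poly q y * v y) = (\<Sum>j=1..n. lam j * poly q (x j)))"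

end

theory Submission
  imports Defs
begin

text \<open>
  Both quadratures become polynomial problems after clearing denominators. Put \<open>D = \<pi>\<^sub>m\<close> for
  distinct parameters \<open>t\<^sub>1, \<dots>, t\<^sub>m\<close>. The products \<open>\<phi>\<^sub>k D\<close> are polynomials of degree below \<open>m\<close>, and because
  the parameters are different they span all of them (\<open>cofactor_expansion\<close>: a partial fraction
  decomposition that also covers a pole at infinity, \<open>t\<^sub>k = 0\<close>). Thus an integral identity for
  all \<open>\<phi>\<^sub>k\<close> against \<open>w\<close> is the same as an identity for all polynomials of degree below \<open>m\<close>
  against \<open>w / D\<close>.

  For Gaussian quadrature, \<open>m = 2n\<close>: the quadrature property says exactly that a rule with \<open>n\<close>
  nodes integrates all polynomials of degree below \<open>2n\<close> against \<open>w / \<pi>\<^sub>2\<^sub>n\<close>. Hence the node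
  polynomial is orthogonal to everything of degree below \<open>n\<close> and has to be a multiple of
  \<open>p\<^sub>n\<close>; conversely the Gauss-Jacobi rule, whose weights are positive, has the property
  (\<open>gaussian_nodes_iff_zeros\<close>).

  For orthogonal quadrature, \<open>r\<^sub>n\<^sub>+\<^sub>1 = P / \<pi>\<^sub>n\<^sub>+\<^sub>1\<close> with \<open>P\<close> of degree at most \<open>n\<close>, and
  orthogonality to \<open>\<phi>\<^sub>1, \<dots>, \<phi>\<^sub>n\<close> for \<open>w\<close> is orthogonality of \<open>P\<close> to \<open>\<pi>\<^sub>n \<phi>\<^sub>i\<close>, that is, to all
  polynomials of degree below \<open>n\<close>, for the weight \<open>w / (\<pi>\<^sub>n \<pi>\<^sub>n\<^sub>+\<^sub>1)\<close>. So \<open>P\<close> is a multiple of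
  \<open>p\<^sub>n\<close> (\<open>orthogonal_nodes_iff_zeros\<close>). If \<open>t\<^sub>1 = 0\<close>, then \<open>\<phi>\<^sub>k \<pi>\<^sub>n \<pi>\<^sub>n\<^sub>+\<^sub>1\<close> has \<open>2n\<close>
  factors of which at least one is constant, so its degree is at most \<open>2n - 1\<close> and the
  Gauss-Jacobi formula applies to it.

  What is needed about orthogonal polynomials (existence, uniqueness up to a factor, \<open>n\<close> simple
  zeros in the open interval, Gauss-Jacobi quadrature with positive weights) uses the weight only
  through the functional \<open>q \<mapsto> \<integral> q v\<close> on polynomials, and of this functional only linearity and
  positivity on nonzero polynomials that are nonnegative on the open interval.
\<close>

section \<open>Orthogonal polynomials of a positive functional\<close>

text \<open>
  The alternative \<open>r = 0\<close> accounts for \<open>m = 0\<close>, where no polynomial has degree below \<open>m\<close>.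
\<close>

lemma reduce_degree:
  fixes p s :: "real poly"
  assumes "p \<noteq> 0" "degree p = m" "degree s \<le> m"
  obtains b r where "s = smult b p + r" "r = 0 \<or> degree r < m"
proof -
  define b where "b = coeff s m / coeff p m"
  define r where "r = s - smult b p"
  have "coeff p m \<noteq> 0" using assms by auto
  then have "coeff r m = 0" by (simp add: r_def b_def)
  moreover have "degree r \<le> m"
    unfolding r_def using assms by (intro degree_diff_le) auto
  ultimately have "r = 0 \<or> degree r < m"
    by (metis leading_coeff_0_iff le_neq_implies_less)
  then show ?thesis using that[of b r] by (simp add: r_def)
qed

locale positive_functional =
  fixes L :: "real poly \<Rightarrow> real"
  assumes L_add: "L (p + q) = L p + L q"
    and L_smult: "L (smult a p) = a * L p"
    and L_pos: "\<lbrakk>q \<noteq> 0; \<And>x. x \<in> {-1<..<1} \<Longrightarrow> 0 \<le> poly q x\<rbrakk> \<Longrightarrow> 0 < L q"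
begin

lemma L_0 [simp]: "L 0 = 0"
  using L_smult[of 0 0] by simp

lemma L_diff: "L (p - q) = L p - L q"
  using L_add[of "p - q" q] by simp

lemma L_sum: "L (\<Sum>i\<in>A. f i) = (\<Sum>i\<in>A. L (f i))"
  by (induction A rule: infinite_finite_induct) (auto simp: L_add)

lemma L_square_pos: "q \<noteq> 0 \<Longrightarrow> 0 < L (q * q)"
  by (rule L_pos) auto

definition orthogonal_poly :: "nat \<Rightarrow> real poly \<Rightarrow> bool" where
  "orthogonal_poly n p \<longleftrightarrow> p \<noteq> 0 \<and> degree p = n \<and> (\<forall>q. degree q < n \<longrightarrow> L (p * q) = 0)"

lemma orthogonal_polyD: "orthogonal_poly n p \<Longrightarrow> r = 0 \<or> degree r < n \<Longrightarrow> L (p * r) = 0"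
  by (auto simp: orthogonal_poly_def)

text \<open>
  Gram-Schmidt, one step at a time: from a monic polynomial of degree \<open>n\<close> that is orthogonal to
  all degrees below \<open>m\<close>, subtracting its component along the orthogonal polynomial of degree \<open>m\<close>
  gains orthogonality to degree \<open>m\<close>.
\<close>

lemma orthogonal_poly_exists: "\<exists>p. orthogonal_poly n p"
proof (induction n rule: less_induct)
  case (less n)
  have "\<exists>q. degree q \<le> n \<and> coeff q n = 1 \<and> (\<forall>s. degree s < m \<longrightarrow> L (q * s) = 0)"
    if "m \<le> n" for m
    using that
  proof (induction m)
    case 0
    show ?case by (intro exI[of _ "monom 1 n"]) (auto simp: degree_monom_le)
  next
    case (Suc m)
    then obtain q where q: "degree q \<le> n" "coeff q n = 1"
        "\<And>s. degree s < m \<Longrightarrow> L (q * s) = 0" by auto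
    obtain p where p: "orthogonal_poly m p" using less.IH[of m] Suc.prems by auto
    then have p': "p \<noteq> 0" "degree p = m" by (auto simp: orthogonal_poly_def)
    define a where "a = L (q * p) / L (p * p)"
    define q' where "q' = q - smult a p"
    have pp: "L (p * p) > 0" using L_square_pos p' by auto
    have "L (q' * s) = 0" if "degree s < Suc m" for s
    proof -
      have "degree s \<le> m" using that by simp
      then obtain b r where s: "s = smult b p + r" "r = 0 \<or> degree r < m"
        using reduce_degree[OF p'] by blast
      have "L (q * r) = 0" using s(2) q(3) by auto
      moreover have "L (p * r) = 0" using orthogonal_polyD[OF p s(2)] .
      moreover have "q' * s = smult b (q * p) + q * r - smult (a * b) (p * p) - smult a (p * r)"
        by (simp add: q'_def s(1) algebra_simps)
      ultimately show ?thesis using pp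
        by (simp add: L_add L_diff L_smult a_def)
    qed
    moreover have "degree q' \<le> n"
      unfolding q'_def using q(1) p' Suc.prems by (intro degree_diff_le) auto
    moreover have "coeff q' n = 1"
      using q(2) p' Suc.prems by (simp add: q'_def coeff_eq_0)
    ultimately show ?case by blast
  qed
  from this[of n] obtain q where q: "degree q \<le> n" "coeff q n = 1"
    "\<And>s. degree s < n \<Longrightarrow> L (q * s) = 0" by auto
  moreover from q have "degree q = n" using le_degree[of q n] by auto
  ultimately show ?case unfolding orthogonal_poly_def by (intro exI[of _ q]) auto
qed

text \<open>
  Subtracting the right multiple of \<open>p\<close> leaves a remainder of degree below \<open>n\<close> which is
  orthogonal to itself.
\<close>

lemma orthogonal_poly_unique:
  assumes p: "orthogonal_poly n p" and P: "degree P \<le> n" "\<And>s. degree s < n \<Longrightarrow> L (P * s) = 0"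
  obtains b where "P = smult b p"
proof -
  from p have p': "p \<noteq> 0" "degree p = n" by (auto simp: orthogonal_poly_def)
  obtain b r where r: "P = smult b p + r" "r = 0 \<or> degree r < n"
    using reduce_degree[OF p' P(1)] .
  have "L (r * r) = L (P * r) - b * L (p * r)"
    by (simp add: r(1) distrib_right L_add L_smult)
  also have "\<dots> = 0" using orthogonal_polyD[OF p r(2)] P(2)[of r] r(2) by auto
  finally have "r = 0" using L_square_pos[of r] by fastforce
  then show ?thesis using that r(1) by auto
qed

text \<open>
  This replaces the usual choice of the zeros of odd multiplicity, at which \<open>p\<close> changes sign.
  Removing one linear factor \<open>x - z\<close> toggles the membership of \<open>z\<close> in \<open>Z\<close>, so multiplicities
  need not be mentioned. The constant \<open>c\<close> carries the sign; a polynomial without zeros keeps the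
  sign of its value at \<open>0\<close>.
\<close>

lemma sign_correcting_zeros:
  fixes p :: "real poly"
  assumes "p \<noteq> 0"
  shows "\<exists>Z c. finite Z \<and> Z \<subseteq> {-1<..<1} \<and> (\<forall>z\<in>Z. poly p z = 0) \<and> c \<noteq> 0 \<and>
    (\<forall>x\<in>{-1<..<1}. 0 \<le> c * poly (p * (\<Prod>z\<in>Z. [:-z, 1:])) x)"
  using assms
proof (induction "degree p" arbitrary: p rule: less_induct)
  case less
  show ?case
  proof (cases "\<exists>z\<in>{-1<..<1}. poly p z = 0")
    case True
    then obtain z where z: "z \<in> {-1<..<1}" "poly p z = 0" by auto
    then obtain q where pq: "p = [:-z, 1:] * q" by (metis dvdE poly_eq_0_iff_dvd)
    with less.prems have q0: "q \<noteq> 0" by auto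
    have "degree q < degree p" unfolding pq using q0
      by (subst degree_mult_eq) auto
    from less.hyps[OF this q0] obtain Z c where Z: "finite Z" "Z \<subseteq> {-1<..<1}"
      "\<forall>z\<in>Z. poly q z = 0" "c \<noteq> 0" 
      "\<forall>x\<in>{-1<..<1}. 0 \<le> c * poly (q * (\<Prod>z\<in>Z. [:-z, 1:])) x" by blast
    show ?thesis
    proof (cases "z \<in> Z")
      case True
      have "p * (\<Prod>z\<in>Z - {z}. [:-z, 1:]) = q * (\<Prod>z\<in>Z. [:-z, 1:])"
        by (simp only: pq prod.remove[OF Z(1) True] mult_ac)
      moreover have "\<forall>y\<in>Z - {z}. poly p y = 0" using Z(3) pq by auto
      ultimately show ?thesis using Z by (intro exI[of _ "Z - {z}"] exI[of _ c]) auto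
    next
      case False
      have eq: "p * (\<Prod>z\<in>insert z Z. [:-z, 1:]) = [:-z, 1:] ^ 2 * (q * (\<Prod>z\<in>Z. [:-z, 1:]))"
        by (simp only: pq prod.insert[OF Z(1) False] power2_eq_square mult_ac)
      have "0 \<le> c * poly (p * (\<Prod>z\<in>insert z Z. [:-z, 1:])) x" if "x \<in> {-1<..<1}" for x
      proof -
        have "c * poly (p * (\<Prod>z\<in>insert z Z. [:-z, 1:])) x
            = (x - z)\<^sup>2 * (c * poly (q * (\<Prod>z\<in>Z. [:-z, 1:])) x)"
          unfolding eq by (simp add: algebra_simps)
        also have "\<dots> \<ge> 0" using Z(5) that by (intro mult_nonneg_nonneg[OF zero_le_power2]) blast
        finally show ?thesis .
      qed
      moreover have "\<forall>y\<in>insert z Z. poly p y = 0" using Z(3) pq by auto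
      ultimately show ?thesis using Z z
        by (intro exI[of _ "insert z Z"] exI[of _ c]) auto
    qed
  next
    case False
    have "0 \<le> poly p 0 * poly p x" if x: "x \<in> {-1<..<1}" for x
    proof (rule ccontr)
      assume "\<not> 0 \<le> poly p 0 * poly p x"
      then have "poly p 0 * poly p x < 0" by simp
      then have "x \<noteq> 0 \<and> (\<exists>y. min 0 x < y \<and> y < max 0 x \<and> poly p y = 0)"
        using poly_IVT[of 0 x p] poly_IVT[of x 0 p]
        by (cases x "0::real" rule: linorder_cases) (auto simp: mult.commute)
      with x False show False by fastforce
    qed
    moreover have "poly p 0 \<noteq> 0" using False by auto
    ultimately show ?thesis by (intro exI[of _ "{}"] exI[of _ "poly p 0"]) auto
  qed
qed

text \<open>
  With fewer than \<open>n\<close> sign-correcting zeros, the product of \<open>p\<close> with their node polynomial would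
  have one sign on the interval, and so a nonzero value under \<open>L\<close>, against orthogonality.
\<close>

lemma orthogonal_poly_zeros:
  assumes p: "orthogonal_poly n p"
  shows "card {y. poly p y = 0} = n" "{y. poly p y = 0} \<subseteq> {-1<..<1}"
proof -
  from p have p': "p \<noteq> 0" "degree p = n" by (auto simp: orthogonal_poly_def)
  obtain Z c where Z: "finite Z" "Z \<subseteq> {-1<..<1}" "\<forall>z\<in>Z. poly p z = 0" "c \<noteq> 0"
      "\<forall>x\<in>{-1<..<1}. 0 \<le> c * poly (p * (\<Prod>z\<in>Z. [:-z, 1:])) x"
    using sign_correcting_zeros[OF p'(1)] by blast
  let ?s = "\<Prod>z\<in>Z. [:-z, 1:] :: real poly"
  have deg: "degree ?s = card Z" by (subst degree_prod_eq_sum_degree) auto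
  have "?s \<noteq> 0" using Z(1) by (simp add: prod_zero_iff)
  with Z p' have "0 < L (smult c (p * ?s))" by (intro L_pos) auto
  then have "\<not> degree ?s < n" using p by (auto simp: L_smult orthogonal_poly_def)
  then have "n \<le> card Z" using deg by simp
  moreover have "finite {y. poly p y = 0}" using p' poly_roots_finite by blast
  moreover have "card {y. poly p y = 0} \<le> n" using card_poly_roots_bound p' by blast
  moreover have sub: "Z \<subseteq> {y. poly p y = 0}" using Z(3) by auto
  ultimately have "Z = {y. poly p y = 0}" "card {y. poly p y = 0} = n"
    by (metis card_subset_eq card_mono dual_order.trans dual_order.antisym)+
  then show "card {y. poly p y = 0} = n" "{y. poly p y = 0} \<subseteq> {-1<..<1}" using Z(2) by auto
qed

end

section \<open>Gauss quadrature for a positive functional\<close>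

definition lagrange :: "real set \<Rightarrow> real \<Rightarrow> real poly" where
  "lagrange X y = smult (1 / (\<Prod>z\<in>X - {y}. y - z)) (\<Prod>z\<in>X - {y}. [:-z, 1:])"

lemma poly_lagrange:
  assumes "finite X" "y \<in> X" "z \<in> X"
  shows "poly (lagrange X y) z = (if z = y then 1 else 0)"
  using assms by (auto simp: lagrange_def poly_prod intro!: prod_zero)

lemma degree_lagrange: "finite X \<Longrightarrow> y \<in> X \<Longrightarrow> degree (lagrange X y) \<le> card X - 1"
  unfolding lagrange_def
  by (rule order_trans[OF degree_smult_le]) (subst degree_prod_eq_sum_degree, auto)

lemma lagrange_interpolation:
  assumes "finite X" "degree q < card X"
  shows "q = (\<Sum>y\<in>X. smult (poly q y) (lagrange X y))"
proof (rule poly_eqI_degree[of X])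
  fix x assume "x \<in> X"
  then show "poly q x = poly (\<Sum>y\<in>X. smult (poly q y) (lagrange X y)) x"
    using assms(1) by (simp add: poly_sum poly_lagrange if_distrib sum.delta cong: sum.cong if_cong)
next
  have "degree (smult (poly q y) (lagrange X y)) \<le> card X - 1" if "y \<in> X" for y
    using degree_lagrange[OF assms(1) that] degree_smult_le order_trans by blast
  then have "degree (\<Sum>y\<in>X. smult (poly q y) (lagrange X y)) \<le> card X - 1"
    by (intro degree_sum_le assms) auto
  then show "degree (\<Sum>y\<in>X. smult (poly q y) (lagrange X y)) < card X" using assms by linarith
qed (use assms in auto)

context positive_functional
begin

text \<open>
  Division by \<open>p\<close> with remainder: the quotient part is annihilated by \<open>L\<close> and vanishes at the zeros
  of \<open>p\<close>, and on the remainder the formula is Lagrange interpolation.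
\<close>

lemma gauss_quadrature:
  assumes p: "orthogonal_poly n p" and "n \<ge> 1" and q: "degree q \<le> 2 * n - 1"
  defines "X \<equiv> {y. poly p y = 0}"
  shows "L q = (\<Sum>y\<in>X. L (lagrange X y) * poly q y)"
proof -
  from p have p': "p \<noteq> 0" "degree p = n" by (auto simp: orthogonal_poly_def)
  have cX: "card X = n" "finite X"
    using orthogonal_poly_zeros[OF p] p' poly_roots_finite by (auto simp: X_def)
  let ?a = "q div p" and ?r = "q mod p"
  have "L (p * ?a) = 0"
  proof (rule orthogonal_polyD[OF p])
    show "?a = 0 \<or> degree ?a < n"
    proof (cases "?a = 0")
      case False
      have "degree ?r \<le> n" using degree_mod_less[OF p'(1), of q] p' by auto
      moreover have "p * ?a = q - ?r" by (simp add: minus_mod_eq_mult_div)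
      ultimately have "degree (p * ?a) \<le> 2 * n - 1"
        using q \<open>n \<ge> 1\<close> by (auto intro: degree_diff_le)
      then show ?thesis using False p' \<open>n \<ge> 1\<close> by (simp add: degree_mult_eq)
    qed simp
  qed
  then have "L q = L ?r" using L_add[of "p * ?a" ?r] by simp
  also have "?r = (\<Sum>y\<in>X. smult (poly ?r y) (lagrange X y))"
    using degree_mod_less[OF p'(1), of q] p' cX \<open>n \<ge> 1\<close>
    by (intro lagrange_interpolation) auto
  also have "\<dots> = (\<Sum>y\<in>X. smult (poly q y) (lagrange X y))"
  proof (intro sum.cong refl)
    fix y assume "y \<in> X"
    then have "poly (p * ?a + ?r) y = poly ?r y"
      by (simp only: poly_add poly_mult X_def mem_Collect_eq mult_zero_left add_0)
    then show "smult (poly ?r y) (lagrange X y) = smult (poly q y) (lagrange X y)"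
      by (simp only: mult_div_mod_eq)
  qed
  finally show ?thesis by (simp add: L_sum L_smult mult.commute)
qed

text \<open>
  The square of a Lagrange polynomial has degree at most \<open>2n - 2\<close> and the same values at the nodes
  as the polynomial itself, so both have the same value under \<open>L\<close>.
\<close>

lemma gauss_weight_pos:
  assumes p: "orthogonal_poly n p" and "n \<ge> 1" and y: "poly p y = 0"
  shows "L (lagrange {y. poly p y = 0} y) > 0"
proof -
  from p have p': "p \<noteq> 0" "degree p = n" by (auto simp: orthogonal_poly_def)
  define X where "X = {y. poly p y = 0}"
  have X: "card X = n" "finite X" "y \<in> X"
    using orthogonal_poly_zeros[OF p] p' poly_roots_finite y by (auto simp: X_def)
  let ?l = "lagrange X y"
  have "degree ?l \<le> n - 1" using degree_lagrange[of X y] X by auto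
  then have "degree (?l * ?l) \<le> 2 * n - 1" using degree_mult_le[of ?l ?l] by linarith
  from gauss_quadrature[OF p \<open>n \<ge> 1\<close> this] X
  have "L (?l * ?l) = L ?l"
    by (simp add: X_def[symmetric] poly_lagrange if_distrib sum.delta cong: sum.cong if_cong)
  moreover have "?l \<noteq> 0" using poly_lagrange[of X y y] X by auto
  ultimately show ?thesis using L_square_pos[of ?l] by (simp add: X_def)
qed

end

section \<open>Integration against a positive weight\<close>

definition weight_functional :: "(real \<Rightarrow> real) \<Rightarrow> real poly \<Rightarrow> real" where
  "weight_functional v q = (LINT y:{-1..1}|lebesgue. poly q y * v y)"

lemma integrable_continuous_mult:
  fixes f w :: "real \<Rightarrow> real"
  assumes "w absolutely_integrable_on {-1..1}" "continuous_on {-1..1} f"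
  shows "set_integrable lebesgue {-1..1} (\<lambda>x. f x * w x)"
proof (rule absolutely_integrable_bounded_measurable_product_real)
  show "f \<in> borel_measurable (lebesgue_on {-1..1})"
    using assms(2) by (intro continuous_imp_measurable_on_sets_lebesgue) auto
  show "bounded (f ` {-1..1})"
    using assms(2) compact_continuous_image compact_imp_bounded by blast
qed (use assms in auto)

text \<open>
  Positivity is strict because the integrand vanishes only on a null set: the zeros of \<open>q\<close>, the end
  points of the interval and the exceptional set of the weight.
\<close>

lemma positive_functional_weight:
  assumes v: "v absolutely_integrable_on {-1..1}"
    and pos: "AE x in lebesgue. x \<in> {-1..1} \<longrightarrow> v x > 0"
  shows "positive_functional (weight_functional v)"
proof
  have int: "set_integrable lebesgue {-1..1} (\<lambda>y. poly q y * v y)" for q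
    using v by (rule integrable_continuous_mult) (intro continuous_intros)
  show "weight_functional v (p + q) = weight_functional v p + weight_functional v q" for p q
    unfolding weight_functional_def
    by (subst set_integral_add(2)[OF int int, symmetric]) (simp add: algebra_simps)
  show "weight_functional v (smult a p) = a * weight_functional v p" for a p
    unfolding weight_functional_def by (simp add: mult.assoc)
  fix q :: "real poly"
  assume q: "q \<noteq> 0" and nn: "\<And>x. x \<in> {-1<..<1} \<Longrightarrow> 0 \<le> poly q x"
  define Z where "Z = insert (-1) (insert 1 {x. poly q x = 0})"
  have Z: "finite Z" unfolding Z_def using q poly_roots_finite by auto
  let ?h = "\<lambda>y. indicator {-1..1} y * (poly q y * v y)"
  have AEZ: "AE x in lebesgue. x \<notin> Z"
    using Z by (intro AE_not_in) (auto simp: negligible_iff_null_sets[symmetric] negligible_finite)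
  have h0: "AE x in lebesgue. 0 \<le> ?h x"
    using pos AEZ
  proof eventually_elim
    case (elim x)
    then show ?case using nn[of x] by (auto simp: indicator_def Z_def)
  qed
  have inth: "integrable lebesgue ?h"
    using int[of q] by (simp add: set_integrable_def)
  have eq: "weight_functional v q = integral\<^sup>L lebesgue ?h"
    by (simp add: weight_functional_def set_lebesgue_integral_def)
  have "integral\<^sup>L lebesgue ?h \<noteq> 0"
  proof
    assume "integral\<^sup>L lebesgue ?h = 0"
    then have "AE x in lebesgue. ?h x = 0"
      using integral_nonneg_eq_0_iff_AE[OF inth h0] by simp
    with pos AEZ have "AE x in lebesgue. x \<notin> {-1..1::real}"
    proof eventually_elim
      case (elim x)
      then show ?case by (auto simp: indicator_def Z_def)
    qed
    then have "emeasure lebesgue {-1..1::real} = 0"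
      by (subst (asm) AE_iff_measurable[of "{-1..1}"]) auto
    then show False by simp
  qed
  moreover have "integral\<^sup>L lebesgue ?h \<ge> 0" using h0 by (rule integral_nonneg_AE)
  ultimately show "0 < weight_functional v q" using eq by fastforce
qed

lemma orthogonal_poly_weight_iff:
  assumes "positive_functional (weight_functional v)"
  shows "positive_functional.orthogonal_poly (weight_functional v) n p \<longleftrightarrow> is_orthogonal_poly v n p"
  unfolding positive_functional.orthogonal_poly_def[OF assms] is_orthogonal_poly_def
    weighted_inner_def weight_functional_def by simp

lemma positive_functional_divided_weight:
  assumes w: "w absolutely_integrable_on {-1..1}"
    and pos: "AE x in lebesgue. x \<in> {-1..1} \<longrightarrow> w x > 0"
    and D: "continuous_on {-1..1} D" "\<And>x. x \<in> {-1..1} \<Longrightarrow> D x > 0"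
  shows "positive_functional (weight_functional (\<lambda>x. w x / D x))"
proof (rule positive_functional_weight)
  have "continuous_on {-1..1} (\<lambda>x. 1 / D x)"
    using D by (intro continuous_intros) (auto dest: D(2) simp: less_imp_neq[symmetric])
  from integrable_continuous_mult[OF w this]
  show "(\<lambda>x. w x / D x) absolutely_integrable_on {-1..1}" by simp
  show "AE x in lebesgue. x \<in> {-1..1} \<longrightarrow> w x / D x > 0"
    using pos by eventually_elim (use D(2) in auto)
qed

lemma enumerates_zeros_exists:
  assumes pf: "positive_functional (weight_functional v)" and p: "is_orthogonal_poly v n p"
  shows "\<exists>x. enumerates_zeros n p x"
proof -
  have "card {y. poly p y = 0} = n"
    using positive_functional.orthogonal_poly_zeros(1)[OF pf] p orthogonal_poly_weight_iff[OF pf]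
    by blast
  moreover have "finite {y. poly p y = 0}"
    using p poly_roots_finite by (auto simp: is_orthogonal_poly_def)
  ultimately show ?thesis
    unfolding enumerates_zeros_def by (metis card_atLeastAtMost diff_Suc_1 finite_atLeastAtMost
        finite_same_card_bij)
qed

lemma christoffel_exists:
  assumes pf: "positive_functional (weight_functional v)" and p: "is_orthogonal_poly v n p"
    and "n \<ge> 1" and x: "enumerates_zeros n p x"
  obtains lam where "is_christoffel v n x lam" "\<And>j. j \<in> {1..n} \<Longrightarrow> lam j > 0"
proof
  interpret positive_functional "weight_functional v" by (fact pf)
  have p': "orthogonal_poly n p" using p orthogonal_poly_weight_iff[OF pf] by blast
  let ?X = "{y. poly p y = 0}"
  let ?lam = "\<lambda>j. weight_functional v (lagrange ?X (x j))"
  have bij: "bij_betw x {1..n} ?X" using x by (simp add: enumerates_zeros_def)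
  show "is_christoffel v n x ?lam"
    unfolding is_christoffel_def
  proof (intro allI impI)
    fix q :: "real poly" assume "degree q \<le> 2 * n - 1"
    from gauss_quadrature[OF p' \<open>n \<ge> 1\<close> this]
    show "(LINT y:{-1..1}|lebesgue. poly q y * v y) = (\<Sum>j=1..n. ?lam j * poly q (x j))"
      by (simp add: weight_functional_def[of v q, symmetric] sum.reindex_bij_betw[OF bij, symmetric])
  qed
  show "?lam j > 0" if "j \<in> {1..n}" for j
    using gauss_weight_pos[OF p' \<open>n \<ge> 1\<close>] bij_betwE[OF bij] that by auto
qed

section \<open>Partial fractions with prescribed poles\<close>

definition pole_poly :: "(nat \<Rightarrow> real) \<Rightarrow> nat set \<Rightarrow> real poly" where
  "pole_poly t S = (\<Prod>i\<in>S. [:1, t i:])"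

lemma poly_pole_poly: "poly (pole_poly t S) x = (\<Prod>i\<in>S. 1 + t i * x)"
  by (simp add: pole_poly_def poly_prod mult.commute)

lemma pi_prod_eq_poly: "pi_prod t m x = poly (pole_poly t {1..m}) x"
  by (simp add: pi_prod_def poly_pole_poly)

lemma pole_poly_insert: "finite S \<Longrightarrow> k \<notin> S \<Longrightarrow> pole_poly t (insert k S) = [:1, t k:] * pole_poly t S"
  by (simp add: pole_poly_def del: mult_pCons_left)

lemma pole_poly_remove: "finite S \<Longrightarrow> k \<in> S \<Longrightarrow> pole_poly t S = [:1, t k:] * pole_poly t (S - {k})"
  using pole_poly_insert[of "S - {k}" k t] by (simp add: insert_absorb)

lemma pole_poly_nonzero: "finite S \<Longrightarrow> pole_poly t S \<noteq> 0"
  by (simp add: pole_poly_def prod_zero_iff)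

lemma degree_pole_poly: "finite S \<Longrightarrow> degree (pole_poly t S) = card {i \<in> S. t i \<noteq> 0}"
proof (induction S rule: finite_induct)
  case (insert k S)
  have "{i \<in> insert k S. t i \<noteq> 0} = (if t k = 0 then {i \<in> S. t i \<noteq> 0} else insert k {i \<in> S. t i \<noteq> 0})"
    by auto
  then show ?case using insert pole_poly_nonzero[of S t]
    by (simp add: pole_poly_insert degree_mult_eq del: mult_pCons_left)
qed (simp add: pole_poly_def)

lemma degree_pole_poly_le: "finite S \<Longrightarrow> degree (pole_poly t S) \<le> card S"
  by (simp add: degree_pole_poly card_mono)

lemma degree_pole_poly_eq_card:
  assumes "finite S" "inj_on t (insert k S)" "k \<notin> S" "t k = 0"
  shows "degree (pole_poly t S) = card S"
proof -
  have "{i \<in> S. t i \<noteq> 0} = S" using assms by (fastforce simp: inj_on_def)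
  then show ?thesis using degree_pole_poly[OF assms(1)] by simp
qed

lemma pole_poly_no_root:
  assumes "finite S" "inj_on t (insert k S)" "k \<notin> S" "t k \<noteq> 0"
  shows "poly (pole_poly t S) (- 1 / t k) \<noteq> 0"
proof -
  have "1 + t i * (- 1 / t k) \<noteq> 0" if "i \<in> S" for i
  proof -
    have "t i \<noteq> t k" using assms that by (auto simp: inj_on_def)
    then show ?thesis using assms(4) by (simp add: field_simps)
  qed
  then show ?thesis using assms(1) by (simp only: poly_pole_poly prod_zero_iff) blast
qed

text \<open>
  The pole of \<open>1 / (1 + t\<^sub>k x)\<close> is no zero of the product over the other indices. For \<open>t\<^sub>k \<noteq> 0\<close>
  this is an evaluation at \<open>- 1 / t\<^sub>k\<close>. For \<open>t\<^sub>k = 0\<close> the pole lies at infinity and the degree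
  decides: all the other parameters are then nonzero, so the product has full degree.
\<close>

lemma pole_poly_not_multiple:
  assumes "finite S" "inj_on t (insert k S)" "k \<notin> S" "s = 0 \<or> degree s < card S"
  shows "pole_poly t S \<noteq> [:1, t k:] * s"
proof
  assume eq: "pole_poly t S = [:1, t k:] * s"
  show False
  proof (cases "t k = 0")
    case True
    then have "pole_poly t S = s" using eq by fastforce
    then show False
      using degree_pole_poly_eq_card[OF assms(1-3) True] assms(4) pole_poly_nonzero[OF assms(1)] by auto
  next
    case False
    then show False
      using pole_poly_no_root[OF assms(1-3) False] by (simp add: eq)
  qed
qed

text \<open>
  Choose \<open>a\<close> such that \<open>q - a \<pi>\<^sub>S\<close> vanishes at the pole of index \<open>k\<close>: by evaluation if the pole is
  finite, and by comparing leading coefficients if it is at infinity.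
\<close>

lemma pole_poly_divide:
  assumes "finite S" "inj_on t (insert k S)" "k \<notin> S" "degree q \<le> card S"
  obtains a s where "q = smult a (pole_poly t S) + [:1, t k:] * s" "s = 0 \<or> degree s < card S"
proof (cases "t k = 0")
  case True
  obtain b r where "q = smult b (pole_poly t S) + r" "r = 0 \<or> degree r < card S"
    using reduce_degree[of "pole_poly t S" "card S" q] assms pole_poly_nonzero
      degree_pole_poly_eq_card[OF assms(1-3) True] by metis
  then show ?thesis using that[of b r] True by simp
next
  case False
  let ?z = "- 1 / t k"
  define a where "a = poly q ?z / poly (pole_poly t S) ?z"
  have "poly (q - smult a (pole_poly t S)) ?z = 0"
    using pole_poly_no_root[OF assms(1-3) False] by (simp add: a_def)
  then obtain u where u: "q - smult a (pole_poly t S) = [:-?z, 1:] * u"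
    by (metis dvdE poly_eq_0_iff_dvd)
  define s where "s = smult (1 / t k) u"
  have e: "[:-?z, 1:] = smult (1 / t k) [:1, t k:]" using False by simp
  have s: "q - smult a (pole_poly t S) = [:1, t k:] * s"
    unfolding u e s_def by (simp only: mult_smult_left mult_smult_right)
  have "degree ([:1, t k:] * s) \<le> card S"
    unfolding s[symmetric] using assms degree_pole_poly_le[OF assms(1), of t]
    by (intro degree_diff_le) (auto intro: order_trans[OF degree_smult_le])
  moreover have "degree ([:1, t k:] * s) = Suc (degree s)" if "s \<noteq> 0"
    using that False by (subst degree_mult_eq) auto
  ultimately have "s = 0 \<or> degree s < card S" by fastforce
  then show ?thesis using that[of a s] s by (simp add: algebra_simps)
qed

text \<open>
  Dividing by the product over \<open>S\<close>, this is the partial fraction decomposition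
  \<open>q / \<pi>\<^sub>S = \<Sum>\<^sub>k a\<^sub>k \<phi>\<^sub>k\<close>. Splitting off one index at a time, with the remainder still divisible by
  the factor of that index, leaves a polynomial to which induction applies.
\<close>

lemma cofactor_expansion:
  assumes "finite S" "inj_on t S" "q = 0 \<or> degree q < card S"
  shows "\<exists>a. q = (\<Sum>k\<in>S. smult (a k) (pole_poly t (S - {k})))"
  using assms
proof (induction S arbitrary: q rule: finite_induct)
  case empty
  then show ?case by auto
next
  case (insert k S)
  have "degree q \<le> card S" using insert by auto
  then obtain a s where s: "q = smult a (pole_poly t S) + [:1, t k:] * s" "s = 0 \<or> degree s < card S"
    using pole_poly_divide[OF insert.hyps(1) insert.prems(1) insert.hyps(2)] by blast
  obtain b where b: "s = (\<Sum>i\<in>S. smult (b i) (pole_poly t (S - {i})))"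
    using insert.IH[OF _ s(2)] insert.prems(1) by auto
  have "[:1, t k:] * s = (\<Sum>i\<in>S. smult (b i) (pole_poly t (insert k S - {i})))"
    unfolding b sum_distrib_left
  proof (intro sum.cong refl)
    fix i assume "i \<in> S"
    then have "insert k S - {i} = insert k (S - {i})" using insert.hyps by auto
    then show "[:1, t k:] * smult (b i) (pole_poly t (S - {i}))
        = smult (b i) (pole_poly t (insert k S - {i}))"
      using insert.hyps by (simp add: pole_poly_insert del: mult_pCons_left)
  qed
  moreover have "insert k S - {k} = S" using insert.hyps by auto
  ultimately have "q = (\<Sum>i\<in>insert k S. smult ((b(k := a)) i) (pole_poly t (insert k S - {i})))"
    using insert.hyps s(1) by (simp cong: sum.cong) (intro sum.cong, auto)
  then show ?case by blast
qed

lemma pole_factor_pos: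
  fixes t :: "nat \<Rightarrow> real"
  assumes "\<forall>i\<ge>1. t i \<in> {-1<..<1}" "x \<in> {-1..1}" "i \<ge> 1"
  shows "0 < 1 + t i * x"
proof -
  have "\<bar>t i * x\<bar> \<le> \<bar>t i\<bar>" using assms(2) by (auto simp: abs_mult intro!: mult_left_le)
  moreover have "\<bar>t i\<bar> < 1" using assms(1,3) by auto
  ultimately show ?thesis by linarith
qed

lemma pi_prod_pos:
  assumes "\<forall>i\<ge>1. t i \<in> {-1<..<1}" "x \<in> {-1..1}"
  shows "0 < pi_prod t m x"
  unfolding pi_prod_def using assms by (intro prod_pos ballI pole_factor_pos) auto

lemma continuous_on_pi_prod [continuous_intros]: "continuous_on A (pi_prod t m)"
  unfolding pi_prod_def by (intro continuous_intros)

lemma poly_cofactor: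
  assumes "finite S" "k \<in> S" "1 + t k * y \<noteq> 0"
  shows "poly (pole_poly t (S - {k})) y = poly (pole_poly t S) y * phi t k y"
  using assms by (simp add: pole_poly_remove[OF assms(1,2)] phi_def field_simps)

section \<open>Nodes for orthogonal quadrature\<close>

text \<open>
  The numerator of \<open>r\<^sub>n\<^sub>+\<^sub>1\<close> over the common denominator \<open>\<pi>\<^sub>n\<^sub>+\<^sub>1\<close>. Keeping the factor of index
  \<open>n + 1\<close> in front of the sum makes it comparable with the division in \<open>pole_poly_divide\<close>.
\<close>

definition r_numerator :: "(nat \<Rightarrow> real) \<Rightarrow> nat \<Rightarrow> (nat \<Rightarrow> real) \<Rightarrow> real poly" where
  "r_numerator t n c = pole_poly t {1..n} +
     [:1, t (n + 1):] * (\<Sum>i=1..n. smult (c i) (pole_poly t ({1..n} - {i})))"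

lemma pi_prod_Suc: "pi_prod t (n + 1) y = (1 + t (n + 1) * y) * pi_prod t n y"
  by (simp add: pi_prod_def mult.commute)

lemma r_fun_eq_quotient:
  assumes t: "\<forall>i\<ge>1. t i \<in> {-1<..<1}" and y: "y \<in> {-1..1}"
  shows "r_fun t n c y = poly (r_numerator t n c) y / pi_prod t (n + 1) y"
proof -
  have nz: "1 + t i * y \<noteq> 0" if "i \<ge> 1" for i
    using pole_factor_pos[OF t y that] by simp
  have "poly (pole_poly t ({1..n} - {i})) y = pi_prod t n y * phi t i y" if "i \<in> {1..n}" for i
    using poly_cofactor[of "{1..n}" i t y] nz[of i] that by (simp add: pi_prod_eq_poly)
  then have "(\<Sum>i=1..n. c i * poly (pole_poly t ({1..n} - {i})) y)
      = (\<Sum>i=1..n. c i * (pi_prod t n y * phi t i y))"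
    by (intro sum.cong refl) simp
  then have "poly (r_numerator t n c) y
      = pi_prod t n y + (1 + t (n + 1) * y) * (\<Sum>i=1..n. c i * (pi_prod t n y * phi t i y))"
    by (simp only: r_numerator_def poly_add poly_mult poly_sum poly_smult pi_prod_eq_poly)
       (simp add: mult.commute)
  also have "(\<Sum>i=1..n. c i * (pi_prod t n y * phi t i y)) = pi_prod t n y * (\<Sum>i=1..n. c i / (1 + t i * y))"
    by (simp add: sum_distrib_left phi_def mult_ac)
  also have "pi_prod t n y + (1 + t (n + 1) * y) * (pi_prod t n y * (\<Sum>i=1..n. c i / (1 + t i * y)))
      = r_fun t n c y * pi_prod t (n + 1) y"
    using nz[of "n + 1"] unfolding r_fun_def pi_prod_Suc by (simp add: field_simps)
  finally show ?thesis using pi_prod_pos[OF t y, of "n + 1"] by simp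
qed

text \<open>
  Otherwise \<open>\<pi>\<^sub>n\<close> would be the factor of index \<open>n + 1\<close> times a polynomial of degree below \<open>n\<close>.
\<close>

lemma r_numerator_nonzero:
  assumes "inj_on t {1..}" "n \<ge> 1"
  shows "r_numerator t n c \<noteq> 0"
proof
  let ?s = "\<Sum>i=1..n. smult (c i) (pole_poly t ({1..n} - {i}))"
  assume "r_numerator t n c = 0"
  then have eq: "pole_poly t {1..n} = [:1, t (n + 1):] * (- ?s)"
    unfolding r_numerator_def mult_minus_right by (rule eq_neg_iff_add_eq_0[THEN iffD2])
  have "degree ?s \<le> n - 1"
  proof (intro degree_sum_le)
    fix i assume "i \<in> {1..n}"
    then show "degree (smult (c i) (pole_poly t ({1..n} - {i}))) \<le> n - 1"
      using degree_pole_poly_le[of "{1..n} - {i}" t]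
      by (intro order_trans[OF degree_smult_le]) auto
  qed simp
  then have "- ?s = 0 \<or> degree (- ?s) < card {1..n}" using assms(2) by (simp, linarith)
  moreover have "inj_on t (insert (n + 1) {1..n})" using assms(1) by (rule inj_on_subset) auto
  ultimately show False
    using pole_poly_not_multiple[of "{1..n}" t "n + 1" "- ?s"] eq by fastforce
qed

lemma degree_r_numerator: "degree (r_numerator t n c) \<le> n"
proof -
  have "degree ([:1, t (n + 1):] * (\<Sum>i=1..n. smult (c i) (pole_poly t ({1..n} - {i})))) \<le> n"
    unfolding sum_distrib_left mult_smult_right
  proof (intro degree_sum_le)
    fix i assume i: "i \<in> {1..n}"
    then have "[:1, t (n + 1):] * pole_poly t ({1..n} - {i}) = pole_poly t (insert (n + 1) ({1..n} - {i}))"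
      by (intro pole_poly_insert[symmetric]) auto
    moreover have "card (insert (n + 1) ({1..n} - {i})) = n" using i by simp
    ultimately show "degree (smult (c i) ([:1, t (n + 1):] * pole_poly t ({1..n} - {i}))) \<le> n"
      using degree_pole_poly_le[of "insert (n + 1) ({1..n} - {i})" t]
      by (intro order_trans[OF degree_smult_le]) auto
  qed simp
  then show ?thesis
    unfolding r_numerator_def using degree_pole_poly_le[of "{1..n}" t] by (intro degree_add_le) auto
qed

text \<open>
  The inner product of \<open>r\<^sub>n\<^sub>+\<^sub>1\<close> with \<open>\<phi>\<^sub>i\<close> is that of the numerator with \<open>\<pi>\<^sub>n \<phi>\<^sub>i\<close> for the new
  weight, and these cofactors span the polynomials of degree below \<open>n\<close>.
\<close>

lemma orthogonal_coeffs_iff: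
  assumes pf: "positive_functional (weight_functional (\<lambda>x. w x / (pi_prod t n x * pi_prod t (n + 1) x)))"
    and t: "\<forall>i\<ge>1. t i \<in> {-1<..<1}" and inj: "inj_on t {1..}"
  shows "orthogonal_coeffs w t n c \<longleftrightarrow>
    (\<forall>s. degree s < n \<longrightarrow>
      weight_functional (\<lambda>x. w x / (pi_prod t n x * pi_prod t (n + 1) x)) (r_numerator t n c * s) = 0)"
proof -
  define L where "L = weight_functional (\<lambda>x. w x / (pi_prod t n x * pi_prod t (n + 1) x))"
  interpret positive_functional L unfolding L_def by (fact pf)
  let ?P = "r_numerator t n c"
  have inner: "weighted_inner w (r_fun t n c) (phi t i) = L (?P * pole_poly t ({1..n} - {i}))"
    if i: "i \<in> {1..n}" for i
    unfolding weighted_inner_def L_def weight_functional_def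
  proof (intro set_lebesgue_integral_cong allI impI)
    fix y :: real assume y: "y \<in> {-1..1}"
    have pos: "1 + t i * y \<noteq> 0" "pi_prod t n y \<noteq> 0" "pi_prod t (n + 1) y \<noteq> 0"
      using pole_factor_pos[OF t y, of i] pi_prod_pos[OF t y, of n] pi_prod_pos[OF t y, of "n + 1"] i
      by auto
    then have "poly (pole_poly t ({1..n} - {i})) y = pi_prod t n y * phi t i y"
      using i by (simp add: poly_cofactor pi_prod_eq_poly)
    then show "r_fun t n c y * phi t i y * w y
        = poly (?P * pole_poly t ({1..n} - {i})) y * (w y / (pi_prod t n y * pi_prod t (n + 1) y))"
      using pos unfolding r_fun_eq_quotient[OF t y] by simp
  qed simp
  show ?thesis
    unfolding L_def[symmetric]
  proof
    assume "orthogonal_coeffs w t n c"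
    then have 0: "L (?P * pole_poly t ({1..n} - {i})) = 0" if "i \<in> {1..n}" for i
      using that inner by (simp add: orthogonal_coeffs_def)
    show "\<forall>s. degree s < n \<longrightarrow> L (?P * s) = 0"
    proof (intro allI impI)
      fix s :: "real poly" assume "degree s < n"
      moreover have "inj_on t {1..n}" using inj by (rule inj_on_subset) auto
      ultimately obtain a where "s = (\<Sum>k=1..n. smult (a k) (pole_poly t ({1..n} - {k})))"
        using cofactor_expansion[of "{1..n}" t s] by auto
      then show "L (?P * s) = 0" using 0
        by (simp add: sum_distrib_left mult_smult_right L_sum L_smult)
    qed
  next
    assume *: "\<forall>s. degree s < n \<longrightarrow> L (?P * s) = 0"
    have "degree (pole_poly t ({1..n} - {i})) < n" if "i \<in> {1..n}" for i
      using degree_pole_poly_le[of "{1..n} - {i}" t] that by simp linarith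
    then show "orthogonal_coeffs w t n c"
      using * inner by (simp add: orthogonal_coeffs_def)
  qed
qed

text \<open>
  This yields the existence of the coefficients in \<open>r\<^sub>n\<^sub>+\<^sub>1\<close>. The leading factor \<open>a\<close> cannot vanish:
  otherwise \<open>p = (1 + t\<^sub>n\<^sub>+\<^sub>1 x) s\<close> with \<open>s\<close> of lower degree, and \<open>p s = (1 + t\<^sub>n\<^sub>+\<^sub>1 x) s\<^sup>2\<close> would
  have positive integral although \<open>p\<close> is orthogonal to \<open>s\<close>.
\<close>

lemma orthogonal_poly_is_numerator:
  assumes pf: "positive_functional (weight_functional v)" and p: "is_orthogonal_poly v n p"
    and t: "\<forall>i\<ge>1. t i \<in> {-1<..<1}" and inj: "inj_on t {1..}"
  obtains a c where "a \<noteq> 0" "p = smult a (r_numerator t n c)"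
proof -
  interpret positive_functional "weight_functional v" by (fact pf)
  have p': "orthogonal_poly n p" using p orthogonal_poly_weight_iff[OF pf] by blast
  have pn: "p \<noteq> 0" "degree p = n" using p by (auto simp: is_orthogonal_poly_def)
  have inj': "inj_on t (insert (n + 1) {1..n})" "inj_on t {1..n}"
    by (rule inj_on_subset[OF inj], force)+
  obtain a s where s: "p = smult a (pole_poly t {1..n}) + [:1, t (n + 1):] * s"
      "s = 0 \<or> degree s < n"
    using pole_poly_divide[OF _ inj'(1), of p] pn by auto
  have a: "a \<noteq> 0"
  proof
    assume "a = 0"
    then have ps: "p = [:1, t (n + 1):] * s" using s by simp
    have "0 < weight_functional v (p * s)"
    proof (rule L_pos)
      show "p * s \<noteq> 0" using ps pn by auto
      fix x :: real assume "x \<in> {-1<..<1}"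
      then have "0 < 1 + t (n + 1) * x" by (intro pole_factor_pos t) auto
      then have "0 \<le> (1 + t (n + 1) * x) * (poly s x * poly s x)"
        by (intro mult_nonneg_nonneg[OF less_imp_le zero_le_square])
      then show "0 \<le> poly (p * s) x" by (simp add: ps algebra_simps)
    qed
    then show False using orthogonal_polyD[OF p' s(2)] by simp
  qed
  obtain b where b: "s = (\<Sum>k=1..n. smult (b k) (pole_poly t ({1..n} - {k})))"
    using cofactor_expansion[OF _ inj'(2), of s] s(2) by auto
  have "smult a (\<Sum>i=1..n. smult (b i / a) (pole_poly t ({1..n} - {i}))) = s"
    unfolding b using a by (intro poly_eqI) (simp add: coeff_sum sum_distrib_left)
  then have "p = smult a (r_numerator t n (\<lambda>i. b i / a))"
    unfolding r_numerator_def s(1) smult_add_right mult_smult_right[symmetric] by simp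
  then show ?thesis using that a by blast
qed

text \<open>
  By orthogonality and its degree, the numerator of \<open>r\<^sub>n\<^sub>+\<^sub>1\<close> is a nonzero multiple of \<open>p\<close>, and the
  denominator is positive on the interval.
\<close>

lemma orthogonal_nodes_iff_zeros:
  assumes pf: "positive_functional (weight_functional (\<lambda>x. w x / (pi_prod t n x * pi_prod t (n + 1) x)))"
    and p: "is_orthogonal_poly (\<lambda>x. w x / (pi_prod t n x * pi_prod t (n + 1) x)) n p"
    and "n \<ge> 1" and t: "\<forall>i\<ge>1. t i \<in> {-1<..<1}" and inj: "inj_on t {1..}"
  shows "is_orthogonal_nodes w t n X \<longleftrightarrow> X = {y. poly p y = 0}"
proof -
  define L where "L = weight_functional (\<lambda>x. w x / (pi_prod t n x * pi_prod t (n + 1) x))"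
  interpret positive_functional L unfolding L_def by (fact pf)
  have p': "orthogonal_poly n p"
    unfolding L_def using p orthogonal_poly_weight_iff[OF pf] by blast
  have zeros: "{x \<in> {-1<..<1}. r_fun t n c x = 0} = {y. poly p y = 0}"
    if "b \<noteq> 0" "r_numerator t n c = smult b p" for b c
  proof -
    have "r_fun t n c x = 0 \<longleftrightarrow> poly p x = 0" if "x \<in> {-1<..<1}" for x
      using r_fun_eq_quotient[OF t, of x n c] pi_prod_pos[OF t, of x "n + 1"] that
        \<open>b \<noteq> 0\<close> \<open>r_numerator t n c = smult b p\<close> by auto
    then show ?thesis using orthogonal_poly_zeros(2)[OF p'] by blast
  qed
  show ?thesis
  proof
    assume "is_orthogonal_nodes w t n X"
    then obtain c where c: "orthogonal_coeffs w t n c" "X = {x \<in> {-1<..<1}. r_fun t n c x = 0}"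
      by (auto simp: is_orthogonal_nodes_def)
    obtain b where b: "r_numerator t n c = smult b p"
      using orthogonal_poly_unique[OF p' degree_r_numerator[of t n c]]
        c(1) orthogonal_coeffs_iff[OF pf t inj] unfolding L_def by blast
    then have "b \<noteq> 0" using r_numerator_nonzero[OF inj \<open>n \<ge> 1\<close>, of c] by auto
    with b zeros c(2) show "X = {y. poly p y = 0}" by blast
  next
    assume X: "X = {y. poly p y = 0}"
    obtain a c where ac: "a \<noteq> 0" "p = smult a (r_numerator t n c)"
      using orthogonal_poly_is_numerator[OF pf p t inj] .
    then have num: "r_numerator t n c = smult (1 / a) p" by simp
    have "orthogonal_coeffs w t n c"
      unfolding orthogonal_coeffs_iff[OF pf t inj] L_def[symmetric] num
      using orthogonal_polyD[OF p'] by (simp add: L_smult)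
    then show "is_orthogonal_nodes w t n X"
      unfolding is_orthogonal_nodes_def X using zeros[OF _ num] ac(1) by auto
  qed
qed

section \<open>Transferring the Gauss-Jacobi formula\<close>

lemma christoffel_quadrature:
  assumes "is_christoffel (\<lambda>y. w y / D y) n x lam" "degree q \<le> 2 * n - 1"
    and D: "\<And>y. y \<in> {-1..1} \<Longrightarrow> D y \<noteq> 0"
    and q: "\<And>y. y \<in> {-1..1} \<Longrightarrow> poly q y = D y * f y"
    and x: "\<And>j. j \<in> {1..n} \<Longrightarrow> x j \<in> {-1..1}"
  shows "(LINT y:{-1..1}|lebesgue. f y * w y) = (\<Sum>j=1..n. (D (x j) * lam j) * f (x j))"
proof -
  have "(LINT y:{-1..1}|lebesgue. f y * w y) = (LINT y:{-1..1}|lebesgue. poly q y * (w y / D y))"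
    by (intro set_lebesgue_integral_cong) (auto simp: q D)
  also have "\<dots> = (\<Sum>j=1..n. lam j * poly q (x j))"
    using assms(1,2) by (auto simp: is_christoffel_def)
  also have "\<dots> = (\<Sum>j=1..n. (D (x j) * lam j) * f (x j))"
    using x by (intro sum.cong) (auto simp: q)
  finally show ?thesis .
qed

lemma gaussian_quadrature_formula:
  assumes chr: "is_christoffel (\<lambda>x. w x / pi_prod t (2 * n) x) n x lam"
    and t: "\<forall>i\<ge>1. t i \<in> {-1<..<1}"
    and x: "\<And>j. j \<in> {1..n} \<Longrightarrow> x j \<in> {-1..1}" and k: "k \<in> {1..2 * n}"
  shows "(LINT y:{-1..1}|lebesgue. phi t k y * w y) =
         (\<Sum>j=1..n. (pi_prod t (2 * n) (x j) * lam j) * phi t k (x j))"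
proof (rule christoffel_quadrature[OF chr])
  let ?q = "pole_poly t ({1..2 * n} - {k})"
  show "degree ?q \<le> 2 * n - 1" using degree_pole_poly_le[of "{1..2 * n} - {k}" t] k by simp
  show "pi_prod t (2 * n) y \<noteq> 0" if "y \<in> {-1..1}" for y
    using pi_prod_pos[OF t that, of "2 * n"] by simp
  show "poly ?q y = pi_prod t (2 * n) y * phi t k y" if "y \<in> {-1..1}" for y
    using pole_factor_pos[OF t that, of k] k by (simp add: poly_cofactor pi_prod_eq_poly)
qed (fact x)

text \<open>
  The index \<open>1\<close> occurs in both products \<open>\<pi>\<^sub>n\<close> and \<open>\<pi>\<^sub>n\<^sub>+\<^sub>1\<close>. Cancelling the factor of index \<open>k\<close> in
  the second one leaves the constant factor of the first one in place even for \<open>k = 1\<close>; this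
  brings the degree from \<open>2n\<close> down to \<open>2n - 1\<close>.
\<close>

lemma orthogonal_quadrature_formula:
  assumes chr: "is_christoffel (\<lambda>x. w x / (pi_prod t n x * pi_prod t (n + 1) x)) n x lam"
    and t: "\<forall>i\<ge>1. t i \<in> {-1<..<1}" and "t 1 = 0" "n \<ge> 1"
    and x: "\<And>j. j \<in> {1..n} \<Longrightarrow> x j \<in> {-1..1}" and k: "k \<in> {1..n + 1}"
  shows "(LINT y:{-1..1}|lebesgue. phi t k y * w y) =
         (\<Sum>j=1..n. (pi_prod t (n + 1) (x j) * pi_prod t n (x j) * lam j) * phi t k (x j))"
proof -
  let ?q = "pole_poly t {1..n} * pole_poly t ({1..n + 1} - {k})"
  have "{i \<in> {1..n}. t i \<noteq> 0} \<subseteq> {1..n} - {1}" using \<open>t 1 = 0\<close> by auto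
  then have "degree (pole_poly t {1..n}) \<le> n - 1"
    using card_mono[of "{1..n} - {1}" "{i \<in> {1..n}. t i \<noteq> 0}"] \<open>n \<ge> 1\<close>
    by (simp add: degree_pole_poly)
  moreover have "degree (pole_poly t ({1..n + 1} - {k})) \<le> n"
    using degree_pole_poly_le[of "{1..n + 1} - {k}" t] k by simp
  ultimately have "degree ?q \<le> 2 * n - 1"
    using degree_mult_le[of "pole_poly t {1..n}" "pole_poly t ({1..n + 1} - {k})"] \<open>n \<ge> 1\<close> by linarith
  then have "(LINT y:{-1..1}|lebesgue. phi t k y * w y) =
         (\<Sum>j=1..n. ((pi_prod t n (x j) * pi_prod t (n + 1) (x j)) * lam j) * phi t k (x j))"
  proof (rule christoffel_quadrature[OF chr])
    show "pi_prod t n y * pi_prod t (n + 1) y \<noteq> 0" if "y \<in> {-1..1}" for y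
      using pi_prod_pos[OF t that, of n] pi_prod_pos[OF t that, of "n + 1"] by simp
    show "poly ?q y = pi_prod t n y * pi_prod t (n + 1) y * phi t k y" if "y \<in> {-1..1}" for y
      using pole_factor_pos[OF t that, of k] k poly_cofactor[of "{1..n + 1}" k t y]
      by (simp add: pi_prod_eq_poly)
  qed (use x in auto)
  then show ?thesis by (simp add: mult_ac)
qed

section \<open>Nodes for Gaussian quadrature\<close>

text \<open>
  Linear combination of the quadrature identities for the \<open>\<phi>\<^sub>k\<close>, with the coefficients of the
  partial fraction decomposition of \<open>q / \<pi>\<^sub>m\<close>.
\<close>

lemma gaussian_nodes_integrate_polys:
  assumes w: "w absolutely_integrable_on {-1..1}" and t: "\<forall>i\<ge>1. t i \<in> {-1<..<1}"
    and inj: "inj_on t {1..}" and X: "X \<subseteq> {-1..1}"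
    and quad: "\<And>k. k \<in> {1..m} \<Longrightarrow>
      (LINT x:{-1..1}|lebesgue. w x / (1 + t k * x)) = (\<Sum>y\<in>X. \<beta> y / (1 + t k * y))"
    and q: "degree q < m"
  shows "weight_functional (\<lambda>x. w x / pi_prod t m x) q = (\<Sum>y\<in>X. \<beta> y / pi_prod t m y * poly q y)"
proof -
  have "inj_on t {1..m}" using inj by (rule inj_on_subset) auto
  then obtain a where a: "q = (\<Sum>k=1..m. smult (a k) (pole_poly t ({1..m} - {k})))"
    using cofactor_expansion[of "{1..m}" t q] q by auto
  have q_div: "poly q y / pi_prod t m y = (\<Sum>k=1..m. a k * (1 / (1 + t k * y)))" if y: "y \<in> {-1..1}" for y
  proof -
    have "poly (pole_poly t ({1..m} - {k})) y = pi_prod t m y * (1 / (1 + t k * y))" if "k \<in> {1..m}" for k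
      using pole_factor_pos[OF t y, of k] that poly_cofactor[of "{1..m}" k t y]
      by (simp add: pi_prod_eq_poly phi_def)
    then have "poly q y = (\<Sum>k=1..m. a k * (pi_prod t m y * (1 / (1 + t k * y))))"
      unfolding a poly_sum poly_smult by (intro sum.cong refl) simp
    also have "\<dots> = pi_prod t m y * (\<Sum>k=1..m. a k * (1 / (1 + t k * y)))"
      unfolding sum_distrib_left by (simp add: mult_ac)
    finally have "poly q y = pi_prod t m y * (\<Sum>k=1..m. a k * (1 / (1 + t k * y)))" .
    then show ?thesis using pi_prod_pos[OF t y, of m] by simp
  qed
  have int: "set_integrable lebesgue {-1..1} (\<lambda>y. a k * (w y / (1 + t k * y)))" if "k \<in> {1..m}" for k
  proof -
    have "1 + t k * y \<noteq> 0" if "y \<in> {-1..1}" for y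
      using pole_factor_pos[OF t that, of k] \<open>k \<in> {1..m}\<close> by auto
    then have "continuous_on {-1..1} (\<lambda>y. a k / (1 + t k * y))" by (intro continuous_intros) auto
    from integrable_continuous_mult[OF w this] show ?thesis by simp
  qed
  have "weight_functional (\<lambda>x. w x / pi_prod t m x) q
      = (LINT y:{-1..1}|lebesgue. (\<Sum>k=1..m. a k * (w y / (1 + t k * y))))"
    unfolding weight_functional_def
  proof (intro set_lebesgue_integral_cong allI impI)
    fix y :: real assume "y \<in> {-1..1}"
    have "poly q y * (w y / pi_prod t m y) = w y * (poly q y / pi_prod t m y)" by simp
    also have "\<dots> = (\<Sum>k=1..m. a k * (w y / (1 + t k * y)))"
      unfolding q_div[OF \<open>y \<in> {-1..1}\<close>] by (simp add: sum_distrib_left mult_ac)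
    finally show "poly q y * (w y / pi_prod t m y) = (\<Sum>k=1..m. a k * (w y / (1 + t k * y)))" .
  qed simp
  also have "\<dots> = (\<Sum>k=1..m. LINT y:{-1..1}|lebesgue. a k * (w y / (1 + t k * y)))"
    using int by (simp add: set_lebesgue_integral_def set_integrable_def sum_distrib_left)
  also have "\<dots> = (\<Sum>k=1..m. a k * (\<Sum>y\<in>X. \<beta> y / (1 + t k * y)))"
    by (intro sum.cong refl) (simp only: set_integral_mult_right quad)
  also have "\<dots> = (\<Sum>y\<in>X. \<beta> y * (\<Sum>k=1..m. a k * (1 / (1 + t k * y))))"
    unfolding sum_distrib_left by (subst sum.swap) (simp add: mult_ac)
  also have "\<dots> = (\<Sum>y\<in>X. \<beta> y / pi_prod t m y * poly q y)"
    using X by (intro sum.cong refl) (subst q_div[symmetric], auto)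
  finally show ?thesis .
qed

text \<open>
  One direction is the orthogonality of the node polynomial, which holds since the rule is exact up
  to degree \<open>2n - 1\<close> and the node polynomial vanishes at the nodes. In the other the weights are
  the Christoffel numbers times \<open>\<pi>\<^sub>2\<^sub>n\<close>, hence positive.
\<close>

lemma gaussian_nodes_iff_zeros:
  assumes w: "w absolutely_integrable_on {-1..1}"
    and pf: "positive_functional (weight_functional (\<lambda>x. w x / pi_prod t (2 * n) x))"
    and p: "is_orthogonal_poly (\<lambda>x. w x / pi_prod t (2 * n) x) n p"
    and n: "n \<ge> 1" and t: "\<forall>i\<ge>1. t i \<in> {-1<..<1}" and inj: "inj_on t {1..}"
  shows "is_gaussian_nodes w t n X \<longleftrightarrow> X = {y. poly p y = 0}"
proof
  define L where "L = weight_functional (\<lambda>x. w x / pi_prod t (2 * n) x)"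
  interpret positive_functional L unfolding L_def by (fact pf)
  have p': "orthogonal_poly n p"
    unfolding L_def using p orthogonal_poly_weight_iff[OF pf] by blast
  have pn: "p \<noteq> 0" "degree p = n" using p by (auto simp: is_orthogonal_poly_def)
  note zeros = orthogonal_poly_zeros[OF p']
  {
    assume "is_gaussian_nodes w t n X"
    then obtain \<beta> where X: "finite X" "card X = n" "X \<subseteq> {-1<..<1}"
      and \<beta>: "\<And>k. k \<in> {1..2 * n} \<Longrightarrow>
        (LINT x:{-1..1}|lebesgue. w x / (1 + t k * x)) = (\<Sum>y\<in>X. \<beta> y / (1 + t k * y))"
      unfolding is_gaussian_nodes_def by blast
    define P :: "real poly" where "P = (\<Prod>y\<in>X. [:-y, 1:])"
    have P: "degree P = n" "P \<noteq> 0"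
      unfolding P_def using X by (auto simp: degree_prod_eq_sum_degree)
    have P_zero: "poly P y = 0 \<longleftrightarrow> y \<in> X" for y
      using X(1) by (auto simp: P_def poly_prod)
    have "L (P * s) = 0" if s: "degree s < n" for s
    proof -
      have "degree (P * s) < 2 * n" using degree_mult_le[of P s] P s by linarith
      then have "L (P * s) = (\<Sum>y\<in>X. \<beta> y / pi_prod t (2 * n) y * poly (P * s) y)"
        unfolding L_def using X(3) \<beta> by (intro gaussian_nodes_integrate_polys[OF w t inj]) auto
      also have "\<dots> = 0" by (intro sum.neutral) (auto simp: P_zero)
      finally show ?thesis .
    qed
    then obtain b where "P = smult b p"
      using orthogonal_poly_unique[OF p', of P] P by auto
    then show "X = {y. poly p y = 0}" using P P_zero by auto
  next
    assume X: "X = {y. poly p y = 0}"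
    obtain x where x: "enumerates_zeros n p x" using enumerates_zeros_exists[OF pf p] ..
    then have bij: "bij_betw x {1..n} X" by (simp add: enumerates_zeros_def X)
    obtain lam where lam: "is_christoffel (\<lambda>x. w x / pi_prod t (2 * n) x) n x lam"
      "\<And>j. j \<in> {1..n} \<Longrightarrow> lam j > 0"
      using christoffel_exists[OF pf p n x] by blast
    have xX: "x j \<in> {-1..1}" if "j \<in> {1..n}" for j
      using bij_betwE[OF bij] that zeros(2) X by fastforce
    define \<beta> where "\<beta> y = pi_prod t (2 * n) y * lam (inv_into {1..n} x y)" for y
    have "\<beta> y > 0" if "y \<in> X" for y
    proof -
      have "inv_into {1..n} x y \<in> {1..n}" using bij that by (metis bij_betw_def inv_into_into)
      moreover have "y \<in> {-1..1}" using that zeros(2) X by fastforce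
      ultimately show ?thesis unfolding \<beta>_def using lam(2) pi_prod_pos[OF t] by simp
    qed
    moreover have "(LINT y:{-1..1}|lebesgue. w y / (1 + t k * y)) = (\<Sum>y\<in>X. \<beta> y / (1 + t k * y))"
      if "k \<in> {1..2 * n}" for k
    proof -
      have "(LINT y:{-1..1}|lebesgue. w y / (1 + t k * y))
          = (\<Sum>j=1..n. (pi_prod t (2 * n) (x j) * lam j) * phi t k (x j))"
        using gaussian_quadrature_formula[OF lam(1) t xX that] by (simp add: phi_def)
      also have "\<dots> = (\<Sum>j=1..n. \<beta> (x j) / (1 + t k * x j))"
        using bij by (intro sum.cong refl) (simp add: \<beta>_def phi_def bij_betw_def inv_into_f_f)
      also have "\<dots> = (\<Sum>y\<in>X. \<beta> y / (1 + t k * y))" by (rule sum.reindex_bij_betw[OF bij])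
      finally show ?thesis .
    qed
    ultimately show "is_gaussian_nodes w t n X"
      unfolding is_gaussian_nodes_def using zeros pn poly_roots_finite[OF pn(1)] X by blast
  }
qed

theorem theorem1:
  fixes w :: "real \<Rightarrow> real" and t :: "nat \<Rightarrow> real" and n :: nat
  assumes "w absolutely_integrable_on {-1..1}"
    and "AE x in lebesgue. x \<in> {-1..1} \<longrightarrow> w x > 0"
    and "n \<ge> 1"
    and "\<And>i. i \<ge> 1 \<Longrightarrow> t i \<in> {-1<..<1}"
    and "inj_on t {1..}"
  shows
    "(let wn = (\<lambda>x. w x / (pi_prod t n x * pi_prod t (n + 1) x)) in
       (\<exists>p. is_orthogonal_poly wn n p) \<and>
       (\<forall>p. is_orthogonal_poly wn n p \<longrightarrow>
         (\<exists>x. enumerates_zeros n p x) \<and>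
         (\<forall>x. enumerates_zeros n p x \<longrightarrow>
           (\<forall>X. is_orthogonal_nodes w t n X \<longleftrightarrow> X = x ` {1..n}) \<and>
           (t 1 = 0 \<longrightarrow>
             (\<exists>lam. is_christoffel wn n x lam) \<and>
             (\<forall>lam. is_christoffel wn n x lam \<longrightarrow>
               (\<forall>k\<in>{1..n + 1}.
                 (LINT y:{-1..1}|lebesgue. phi t k y * w y) =
                 (\<Sum>j=1..n. (pi_prod t (n + 1) (x j) * pi_prod t n (x j) * lam j)
                              * phi t k (x j))))))))
     \<and>
     (let wn = (\<lambda>x. w x / pi_prod t (2 * n) x) in
       (\<exists>p. is_orthogonal_poly wn n p) \<and>
       (\<forall>p. is_orthogonal_poly wn n p \<longrightarrow>
         (\<exists>x. enumerates_zeros n p x) \<and>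
         (\<forall>x. enumerates_zeros n p x \<longrightarrow>
           (\<forall>X. is_gaussian_nodes w t n X \<longleftrightarrow> X = x ` {1..n}) \<and>
           (\<exists>lam. is_christoffel wn n x lam) \<and>
           (\<forall>lam. is_christoffel wn n x lam \<longrightarrow>
             (\<forall>k\<in>{1..2 * n}.
               (LINT y:{-1..1}|lebesgue. phi t k y * w y) =
               (\<Sum>j=1..n. (pi_prod t (2 * n) (x j) * lam j) * phi t k (x j)))))))"
proof -
  have t: "\<forall>i\<ge>1. t i \<in> {-1<..<1}" using assms(4) by blast
  note inj = assms(5)
  define v where "v = (\<lambda>x. w x / (pi_prod t n x * pi_prod t (n + 1) x))"
  define u where "u = (\<lambda>x. w x / pi_prod t (2 * n) x)"
  have pf_v: "positive_functional (weight_functional v)"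
    unfolding v_def
    by (intro positive_functional_divided_weight assms(1,2) continuous_intros mult_pos_pos pi_prod_pos t)
  have pf_u: "positive_functional (weight_functional u)"
    unfolding u_def
    by (intro positive_functional_divided_weight assms(1,2) continuous_intros pi_prod_pos t)
  have ex: "\<exists>p. is_orthogonal_poly v' n p" if "positive_functional (weight_functional v')" for v'
    using positive_functional.orthogonal_poly_exists[OF that] orthogonal_poly_weight_iff[OF that]
    by blast
  have range: "x ` {1..n} = {y. poly p y = 0}" "\<And>j. j \<in> {1..n} \<Longrightarrow> x j \<in> {-1..1}"
    if pf: "positive_functional (weight_functional v')" and p: "is_orthogonal_poly v' n p"
      and x: "enumerates_zeros n p x" for v' p x
  proof -
    show img: "x ` {1..n} = {y. poly p y = 0}"
      using x by (simp add: enumerates_zeros_def bij_betw_def)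
    have "{y. poly p y = 0} \<subseteq> {-1<..<1}"
      using positive_functional.orthogonal_poly_zeros(2)[OF pf] p orthogonal_poly_weight_iff[OF pf]
      by blast
    then show "x j \<in> {-1..1}" if "j \<in> {1..n}" for j using img that by fastforce
  qed
  show ?thesis
    unfolding Let_def v_def[symmetric] u_def[symmetric]
  proof (intro conjI allI impI ballI)
    show "\<exists>p. is_orthogonal_poly v n p" by (rule ex[OF pf_v])
    show "\<exists>p. is_orthogonal_poly u n p" by (rule ex[OF pf_u])
  next
    fix p assume p: "is_orthogonal_poly v n p"
    show "\<exists>x. enumerates_zeros n p x" by (rule enumerates_zeros_exists[OF pf_v p])
    fix x assume x: "enumerates_zeros n p x"
    note range = range[OF pf_v p x]
    show "is_orthogonal_nodes w t n X \<longleftrightarrow> X = x ` {1..n}" for X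
      using orthogonal_nodes_iff_zeros[OF _ _ assms(3) t inj] pf_v p range(1) unfolding v_def by simp
    assume t1: "t 1 = 0"
    show "\<exists>lam. is_christoffel v n x lam"
      using christoffel_exists[OF pf_v p assms(3) x] by blast
    fix lam k assume "is_christoffel v n x lam" "k \<in> {1..n + 1}"
    then show "(LINT y:{-1..1}|lebesgue. phi t k y * w y) =
        (\<Sum>j=1..n. (pi_prod t (n + 1) (x j) * pi_prod t n (x j) * lam j) * phi t k (x j))"
      unfolding v_def by (intro orthogonal_quadrature_formula t t1 assms(3) range(2))
  next
    fix p assume p: "is_orthogonal_poly u n p"
    show "\<exists>x. enumerates_zeros n p x" by (rule enumerates_zeros_exists[OF pf_u p])
    fix x assume x: "enumerates_zeros n p x"
    note range = range[OF pf_u p x]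
    show "is_gaussian_nodes w t n X \<longleftrightarrow> X = x ` {1..n}" for X
      using gaussian_nodes_iff_zeros[OF assms(1) _ _ assms(3) t inj] pf_u p range(1)
      unfolding u_def by simp
    show "\<exists>lam. is_christoffel u n x lam"
      using christoffel_exists[OF pf_u p assms(3) x] by blast
    fix lam k assume "is_christoffel u n x lam" "k \<in> {1..2 * n}"
    then show "(LINT y:{-1..1}|lebesgue. phi t k y * w y) =
        (\<Sum>j=1..n. (pi_prod t (2 * n) (x j) * lam j) * phi t k (x j))"
      unfolding u_def by (intro gaussian_quadrature_formula t range(2))
  qed
qed

end
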